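(* Fix the teacher and the fresh unlabeled sample (i.e. condition on them), and suppose the oracle denominator $D:=R+R_{\mathrm{pd}}-2C$ is bounded away from zero. If the calibration sample is independent, $n_{\rm cal}\to\infty$, and the conditional variances of $e^2$, $(e^{\mathrm{pd}})^2$ and $e\,e^{\mathrm{pd}}$ are uniformly bounded, then $$\widehat\xi^\star_{\rm cal}-\xi^\star\xrightarrow{p}0,\qquad \widehat R^\star_{\mathsf{pmsd},{\rm cal}}-R^\star_{\mathsf{pmsd}}\xrightarrow{p}0.$$ Moreover, the same convergence holds uniformly over any fixed finite collection of candidate students: if $f_{\mathrm{pd}}^{(1)},\dots,f_{\mathrm{pd}}^{(J)}$ ($J<\infty$ fixed) are candidate students whose oracle denominators satisfy $\min_{j}D_j\ge d_0$ for some $d_0>0$, and the conditional variances of $e^2$, $(e_j^{\mathrm{pd}})^2$, $e\,e_j^{\mathrm{pd}}$ are bounded uniformly over $j$, then $$\max_{1\le j\le J}\big|\widehat\xi^\star_{{\rm cal},j}-\xi^\star_j\big|\xrightarrow{p}0,\qquad \max_{1\le j\le J}\big|\widehat R^\star_{\mathsf{pmsd},{\rm cal},j}-R^\star_{\mathsf{pmsd},j}\big|\xrightarrow{p}0.$$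
   Context: Conditionally on the teacher and the fresh unlabeled data, the teacher $f$ and the pure-distilled student $f_{\mathrm{pd}}$ (or each candidate student $f_{\mathrm{pd}}^{(j)}$) are fixed real-valued predictors. For an independent test point $(x,y)$ from the target distribution, let $e=y-f(x)$ and $e^{\mathrm{pd}}=y-f_{\mathrm{pd}}(x)$, and (conditional expectations given the teacher and unlabeled data) $R=\mathbb E[e^2]$, $R_{\mathrm{pd}}=\mathbb E[(e^{\mathrm{pd}})^2]$, $C=\mathbb E[e\,e^{\mathrm{pd}}]$, $D=R+R_{\mathrm{pd}}-2C$. The oracle mixing weight and risk are those minimizing the risk of $(1-\xi)f+\xi f_{\mathrm{pd}}$ over $\xi\in\mathbb R$: $$\xi^\star=\frac{R-C}{D},\qquad R^\star_{\mathsf{pmsd}}=R-\frac{(R-C)^2}{D}.$$ The calibration set $\{(x_i^{\rm cal},y_i^{\rm cal})\}_{i=1}^{n_{\rm cal}}$ is an i.i.d. labeled sample from the target distribution, independent of the teacher and the unlabeled data. With $\hat e_i=y_i^{\rm cal}-f(x_i^{\rm cal})$ and $\hat e_i^{\mathrm{pd}}=y_i^{\rm cal}-f_{\mathrm{pd}}(x_i^{\rm cal})$, let $$\widehat R^{\rm cal}=\frac1{n_{\rm cal}}\sum_i\hat e_i^2,\quad \widehat R_{\mathrm{pd}}^{\rm cal}=\frac1{n_{\rm cal}}\sum_i(\hat e_i^{\mathrm{pd}})^2,\quad \widehat C^{\rm cal}=\frac1{n_{\rm cal}}\sum_i\hat e_i\hat e_i^{\mathrm{pd}},$$ $$\widehat\xi^\star_{\rm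 cal}=\frac{\widehat R^{\rm cal}-\widehat C^{\rm cal}}{\widehat R^{\rm cal}+\widehat R_{\mathrm{pd}}^{\rm cal}-2\widehat C^{\rm cal}},\qquad \widehat R^\star_{\mathsf{pmsd},{\rm cal}}=\widehat R^{\rm cal}-\frac{(\widehat R^{\rm cal}-\widehat C^{\rm cal})^2}{\widehat R^{\rm cal}+\widehat R_{\mathrm{pd}}^{\rm cal}-2\widehat C^{\rm cal}}.$$ Quantities with subscript $j$ are the same quantities with $f_{\mathrm{pd}}$ replaced by $f_{\mathrm{pd}}^{(j)}$. $\xrightarrow{p}$ denotes convergence in probability. *)

theory Defs
  imports "HOL-Probability.Probability"
begin

text \<open>
  A labelled point is a pair z = (x, y) of type 'x \<times> real, and P is the target distribution on
  such pairs. In this section predictors are ordinary (non-random) functions on feature space.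
\<close>

definition resid :: "('x \<Rightarrow> real) \<Rightarrow> 'x \<times> real \<Rightarrow> real" where
  "resid f z = snd z - f (fst z)"

definition risk :: "('x \<times> real) measure \<Rightarrow> ('x \<Rightarrow> real) \<Rightarrow> real" where
  "risk P f = (\<integral>z. (resid f z)\<^sup>2 \<partial>P)"

definition cross_risk :: "('x \<times> real) measure \<Rightarrow> ('x \<Rightarrow> real) \<Rightarrow> ('x \<Rightarrow> real) \<Rightarrow> real" where
  "cross_risk P f fpd = (\<integral>z. resid f z * resid fpd z \<partial>P)"

definition oracle_denom :: "('x \<times> real) measure \<Rightarrow> ('x \<Rightarrow> real) \<Rightarrow> ('x \<Rightarrow> real) \<Rightarrow> real" where
  "oracle_denom P f fpd = risk P f + risk P fpd - 2 * cross_risk P f fpd"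

definition oracle_weight :: "('x \<times> real) measure \<Rightarrow> ('x \<Rightarrow> real) \<Rightarrow> ('x \<Rightarrow> real) \<Rightarrow> real" where
  "oracle_weight P f fpd = (risk P f - cross_risk P f fpd) / oracle_denom P f fpd"

definition oracle_risk :: "('x \<times> real) measure \<Rightarrow> ('x \<Rightarrow> real) \<Rightarrow> ('x \<Rightarrow> real) \<Rightarrow> real" where
  "oracle_risk P f fpd = risk P f - (risk P f - cross_risk P f fpd)\<^sup>2 / oracle_denom P f fpd"

text \<open>The closed forms above are the minimizer and the minimum of the risk of the mixtures.\<close>

lemma oracle_minimizes_mixture_risk:
  fixes f fpd :: "'x \<Rightarrow> real"
  assumes "integrable P (\<lambda>z. (resid f z)\<^sup>2)" "integrable P (\<lambda>z. (resid fpd z)\<^sup>2)"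
    and "integrable P (\<lambda>z. resid f z * resid fpd z)"
    and D: "oracle_denom P f fpd > 0"
  shows "risk P (\<lambda>x. (1 - \<xi>) * f x + \<xi> * fpd x) =
      oracle_risk P f fpd + oracle_denom P f fpd * (\<xi> - oracle_weight P f fpd)\<^sup>2"
proof -
  have "risk P (\<lambda>x. (1 - \<xi>) * f x + \<xi> * fpd x) =
      (\<integral>z. (1 - \<xi>)\<^sup>2 * (resid f z)\<^sup>2 + \<xi>\<^sup>2 * (resid fpd z)\<^sup>2
        + (2 * \<xi> * (1 - \<xi>)) * (resid f z * resid fpd z) \<partial>P)"
    unfolding risk_def
    by (rule Bochner_Integration.integral_cong) (auto simp: resid_def power2_eq_square algebra_simps)
  also have "\<dots> = (1 - \<xi>)\<^sup>2 * risk P f + \<xi>\<^sup>2 * risk P fpd + (2 * \<xi> * (1 - \<xi>)) * cross_risk P f fpd"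
    using assms(1-3) by (simp add: risk_def cross_risk_def)
  also have "\<dots> = risk P f - 2 * \<xi> * (risk P f - cross_risk P f fpd) + \<xi>\<^sup>2 * oracle_denom P f fpd"
    by (simp add: oracle_denom_def power2_eq_square algebra_simps)
  also have "\<dots> = oracle_risk P f fpd + oracle_denom P f fpd * (\<xi> - oracle_weight P f fpd)\<^sup>2"
    using D by (simp add: oracle_risk_def oracle_weight_def power2_eq_square field_simps)
  finally show ?thesis .
qed

text \<open>
  Plug-in versions from a calibration sample z 0, ..., z (n - 1). Since x / 0 = 0, the estimators
  are total; where the empirical denominator is nonzero they are the usual quotients.
\<close>

definition emp_risk :: "nat \<Rightarrow> (nat \<Rightarrow> 'x \<times> real) \<Rightarrow> ('x \<Rightarrow> real) \<Rightarrow> real" where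
  "emp_risk n z f = (1 / real n) * (\<Sum>i<n. (resid f (z i))\<^sup>2)"

definition emp_cross_risk :: "nat \<Rightarrow> (nat \<Rightarrow> 'x \<times> real) \<Rightarrow> ('x \<Rightarrow> real) \<Rightarrow> ('x \<Rightarrow> real) \<Rightarrow> real" where
  "emp_cross_risk n z f fpd = (1 / real n) * (\<Sum>i<n. resid f (z i) * resid fpd (z i))"

definition emp_denom :: "nat \<Rightarrow> (nat \<Rightarrow> 'x \<times> real) \<Rightarrow> ('x \<Rightarrow> real) \<Rightarrow> ('x \<Rightarrow> real) \<Rightarrow> real" where
  "emp_denom n z f fpd = emp_risk n z f + emp_risk n z fpd - 2 * emp_cross_risk n z f fpd"

definition cal_weight :: "nat \<Rightarrow> (nat \<Rightarrow> 'x \<times> real) \<Rightarrow> ('x \<Rightarrow> real) \<Rightarrow> ('x \<Rightarrow> real) \<Rightarrow> real" where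
  "cal_weight n z f fpd = (emp_risk n z f - emp_cross_risk n z f fpd) / emp_denom n z f fpd"

definition cal_risk :: "nat \<Rightarrow> (nat \<Rightarrow> 'x \<times> real) \<Rightarrow> ('x \<Rightarrow> real) \<Rightarrow> ('x \<Rightarrow> real) \<Rightarrow> real" where
  "cal_risk n z f fpd =
     emp_risk n z f - (emp_risk n z f - emp_cross_risk n z f fpd)\<^sup>2 / emp_denom n z f fpd"

text \<open>
  Square integrability has to be stated separately: the Bochner integral of a non-integrable
  function is 0, so a bound on the variance alone would not say that the variance is finite.
\<close>

definition variance_le :: "'z measure \<Rightarrow> ('z \<Rightarrow> real) \<Rightarrow> real \<Rightarrow> bool" where
  "variance_le P u V \<longleftrightarrow>
     integrable P u \<and> integrable P (\<lambda>z. (u z)\<^sup>2) \<and> prob_space.variance P u \<le> V"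

definition variances_le :: "('x \<times> real) measure \<Rightarrow> ('x \<Rightarrow> real) \<Rightarrow> ('x \<Rightarrow> real) \<Rightarrow> real \<Rightarrow> bool" where
  "variances_le P f fpd V \<longleftrightarrow>
     variance_le P (\<lambda>z. (resid f z)\<^sup>2) V \<and>
     variance_le P (\<lambda>z. (resid fpd z)\<^sup>2) V \<and>
     variance_le P (\<lambda>z. resid f z * resid fpd z) V"

text \<open>
  The random element W on M collects the teacher and the fresh unlabelled data, and
  \<open>\<sigma>_alg M W S\<close> is the information it carries. A calibration sample of size n is an i.i.d. sample
  from P that is, as a whole, independent of W. (Independence is phrased with sigma-algebras
  because the library's \<open>indep_var\<close> needs both variables to have the same type.)
\<close>

definition \<sigma>_alg :: "'w measure \<Rightarrow> ('w \<Rightarrow> 't) \<Rightarrow> 't measure \<Rightarrow> 'w measure" where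
  "\<sigma>_alg M W S = vimage_algebra (space M) W S"

definition calibration_sample ::
  "'w measure \<Rightarrow> ('w \<Rightarrow> 't) \<Rightarrow> 't measure \<Rightarrow> 'z measure \<Rightarrow> nat \<Rightarrow> (nat \<Rightarrow> 'w \<Rightarrow> 'z) \<Rightarrow> bool" where
  "calibration_sample M W S P n Z \<longleftrightarrow>
     prob_space.indep_vars M (\<lambda>_. P) Z {..<n} \<and>
     (\<forall>i<n. distr M P (Z i) = P) \<and>
     prob_space.indep_set M (sets (\<sigma>_alg M W S))
       (sets (\<sigma>_alg M (\<lambda>\<omega>. \<lambda>i\<in>{..<n}. Z i \<omega>) (Pi\<^sub>M {..<n} (\<lambda>_. P))))"

text \<open>
  Convergence to 0 in probability conditionally on a sub-sigma-algebra G, on the event A: for every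
  \<open>\<epsilon> > 0\<close>, the conditional probability given G that \<open>\<bar>X k\<bar> > \<epsilon>\<close> tends to 0 almost surely on A.
  The quantifier over \<open>\<epsilon>\<close> is outside the almost-sure quantifier because each conditional
  probability is only determined up to a null set. If G is trivial and A is the whole space, this
  is convergence in probability.
\<close>

definition cond_tendsto0_in_prob ::
  "'w measure \<Rightarrow> 'w measure \<Rightarrow> 'w set \<Rightarrow> (nat \<Rightarrow> 'w \<Rightarrow> real) \<Rightarrow> bool" where
  "cond_tendsto0_in_prob M G A X \<longleftrightarrow>
     (\<forall>\<epsilon>>0. AE \<omega> in M. \<omega> \<in> A \<longrightarrow>
        (\<lambda>k. real_cond_exp M G (indicator {\<omega>' \<in> space M. \<bar>X k \<omega>'\<bar> > \<epsilon>}) \<omega>) \<longlonglongrightarrow> 0)"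

end

theory Submission
  imports Defs
begin

text \<open>
  Write \<open>W\<close> for the teacher together with the unlabelled data. Since the calibration sample is
  independent of \<open>W\<close>, conditioning on \<open>W\<close> amounts to freezing it: the conditional probability
  given \<open>W\<close> of an event about \<open>W\<close> and the sample is the probability of its slice at the observed
  value of \<open>W\<close>, computed under the product law \<open>P\<^sup>n\<close> of the sample
  (\<open>real_cond_exp_indicator_indep\<close>). This identity holds outside a null set for each sample size,
  hence almost surely for all of them at once, and what remains is a statement about fixed
  predictors under \<open>P\<^sup>n\<close> with \<open>n \<rightarrow> \<infinity>\<close> (\<open>cond_tendsto0_in_prob_calibration\<close>).

  For fixed predictors, the weight and the risk are values of a fixed function of the triple
  (teacher risk, student risk, cross risk), at the empirical triple for the estimators and at the
  population triple for the oracles. Finite variances make each empirical average close to its mean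
  by Chebyshev's inequality, and the two functions are continuous wherever the denominator is
  nonzero, so the plug-in errors tend to 0 in probability (\<open>plug_in_tendsto_in_prob\<close>). The maximum
  over finitely many students costs only a union bound (\<open>Max_plug_in_error_cond_tendsto0\<close>), and a
  single student is the case of a one-element collection.
\<close>

section \<open>Weak law of large numbers under a product measure\<close>

text \<open>
  The variance of a sum of independent centred variables is the sum of the variances: in the
  expanded square, the mixed terms factor over the coordinates and each factor has mean 0.
\<close>

lemma integral_PiM_square_sum:
  fixes u :: "'z \<Rightarrow> real"
  assumes "prob_space P" and u: "integrable P u" and u2: "integrable P (\<lambda>z. (u z)\<^sup>2)"
    and mean: "(\<integral>z. u z \<partial>P) = 0"
  shows "integrable (Pi\<^sub>M {..<n} (\<lambda>_. P)) (\<lambda>z. (\<Sum>i<n. u (z i))\<^sup>2)" (is ?int)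
    and "(\<integral>z. (\<Sum>i<n. u (z i))\<^sup>2 \<partial>Pi\<^sub>M {..<n} (\<lambda>_. P)) = real n * (\<integral>z. (u z)\<^sup>2 \<partial>P)" (is ?eq)
proof -
  interpret P: prob_space P by fact
  interpret product_sigma_finite "\<lambda>_::nat. P"
    by (rule product_sigma_finite.intro) (rule P.sigma_finite_measure_axioms)
  let ?Pn = "Pi\<^sub>M {..<n} (\<lambda>_. P)"
  \<comment> \<open>u (z i) * u (z j) as a product over all coordinates, so that one product rule covers both
    the diagonal and the mixed terms.\<close>
  define g where "g i j k = (if k = i then if k = j then \<lambda>z. (u z)\<^sup>2 else u
      else if k = j then u else (\<lambda>_. 1))" for i j k :: nat
  have g: "integrable P (g i j k)" for i j k
    unfolding g_def using u u2 by simp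
  have prod_g: "(\<Prod>k<n. g i j k (z k)) = u (z i) * u (z j)" if "i < n" "j < n" for i j z
  proof -
    have "(\<Prod>k<n. g i j k (z k)) = (\<Prod>k<n. (if k = i then u (z k) else 1) * (if k = j then u (z k) else 1))"
      by (intro prod.cong) (auto simp: g_def power2_eq_square)
    also have "\<dots> = u (z i) * u (z j)"
      using that by (simp add: prod.distrib prod.delta)
    finally show ?thesis .
  qed
  have int_ij: "integrable ?Pn (\<lambda>z. u (z i) * u (z j))" if "i < n" "j < n" for i j
    using product_integrable_prod[of "{..<n}" "g i j"] g prod_g[OF that] by simp
  have E_ij: "(\<integral>z. u (z i) * u (z j) \<partial>?Pn) = (if i = j then \<integral>z. (u z)\<^sup>2 \<partial>P else 0)"
    if "i < n" "j < n" for i j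
  proof -
    have "(\<integral>z. u (z i) * u (z j) \<partial>?Pn) = (\<Prod>k<n. \<integral>z. g i j k z \<partial>P)"
      using product_integral_prod[of "{..<n}" "g i j"] g prod_g[OF that] by simp
    also have "\<dots> = (if i = j then \<integral>z. (u z)\<^sup>2 \<partial>P else 0)"
    proof (cases "i = j")
      case True
      then have "(\<Prod>k<n. \<integral>z. g i j k z \<partial>P) = (\<Prod>k<n. if k = i then \<integral>z. (u z)\<^sup>2 \<partial>P else 1)"
        by (intro prod.cong) (auto simp: g_def P.prob_space)
      with True that show ?thesis by simp
    next
      case False
      then have "(\<integral>z. g i j i z \<partial>P) = 0"
        using mean by (simp add: g_def)
      with False that show ?thesis by (auto intro!: prod_zero)
    qed
    finally show ?thesis .
  qed
  have sq: "(\<Sum>i<n. u (z i))\<^sup>2 = (\<Sum>i<n. \<Sum>j<n. u (z i) * u (z j))" for z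
    by (simp add: power2_eq_square sum_product)
  show ?int
    unfolding sq by (intro Bochner_Integration.integrable_sum int_ij) auto
  have "(\<integral>z. (\<Sum>i<n. u (z i))\<^sup>2 \<partial>?Pn) = (\<Sum>i<n. \<integral>z. (\<Sum>j<n. u (z i) * u (z j)) \<partial>?Pn)"
    unfolding sq
    by (intro Bochner_Integration.integral_sum Bochner_Integration.integrable_sum int_ij) auto
  also have "\<dots> = (\<Sum>i<n. \<Sum>j<n. \<integral>z. u (z i) * u (z j) \<partial>?Pn)"
    by (intro sum.cong refl Bochner_Integration.integral_sum int_ij) auto
  also have "\<dots> = real n * (\<integral>z. (u z)\<^sup>2 \<partial>P)"
    by (simp add: E_ij)
  finally show ?eq .
qed

text \<open>
  Chebyshev's inequality bounds the deviation probability by \<open>Var u / (n * \<delta>\<^sup>2)\<close>.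
\<close>

lemma sample_mean_tendsto_in_prob:
  fixes u :: "'z \<Rightarrow> real"
  assumes "prob_space P" and u: "integrable P u" and u2: "integrable P (\<lambda>z. (u z)\<^sup>2)"
    and \<delta>: "\<delta> > 0"
  shows "(\<lambda>n. measure (Pi\<^sub>M {..<n} (\<lambda>_. P))
      {z \<in> space (Pi\<^sub>M {..<n} (\<lambda>_. P)). \<delta> \<le> \<bar>1 / real n * (\<Sum>i<n. u (z i)) - (\<integral>z. u z \<partial>P)\<bar>}) \<longlonglongrightarrow> 0"
    (is "(\<lambda>n. measure _ (?B n)) \<longlonglongrightarrow> 0")
proof -
  interpret P: prob_space P by fact
  define m where "m = (\<integral>z. u z \<partial>P)"
  define v where "v z = u z - m" for z
  have v: "integrable P v" and mean: "(\<integral>z. v z \<partial>P) = 0"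
    unfolding v_def using u by (auto simp: m_def P.prob_space)
  have v2: "integrable P (\<lambda>z. (v z)\<^sup>2)"
    unfolding v_def power2_diff using u u2 by simp
  have bound: "measure (Pi\<^sub>M {..<n} (\<lambda>_. P)) (?B n) \<le> (\<integral>z. (v z)\<^sup>2 \<partial>P) / \<delta>\<^sup>2 / real n" if n: "n > 0" for n
  proof -
    let ?Pn = "Pi\<^sub>M {..<n} (\<lambda>_. P)"
    interpret Pn: prob_space ?Pn by (intro prob_space_PiM assms(1))
    have [measurable]: "v \<in> borel_measurable P" using v by simp
    have "1 / real n * (\<Sum>i<n. u (z i)) - m = (\<Sum>i<n. v (z i)) / real n" for z
      using n by (simp add: v_def sum_subtractf diff_divide_distrib)
    then have "?B n = {z \<in> space ?Pn. \<bar>\<Sum>i<n. v (z i)\<bar> \<ge> real n * \<delta>}"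
      using n unfolding m_def[symmetric] by (auto simp: field_simps)
    also have "measure ?Pn \<dots> \<le> (\<integral>z. (\<Sum>i<n. v (z i))\<^sup>2 \<partial>?Pn) / (real n * \<delta>)\<^sup>2"
      using n \<delta> by (intro Pn.second_moment_method integral_PiM_square_sum(1)[OF assms(1) v v2 mean]) auto
    also have "\<dots> = (\<integral>z. (v z)\<^sup>2 \<partial>P) / \<delta>\<^sup>2 / real n"
      unfolding integral_PiM_square_sum(2)[OF assms(1) v v2 mean]
      using n by (simp add: power2_eq_square)
    finally show ?thesis .
  qed
  show ?thesis
  proof (rule tendsto_sandwich[OF _ _ tendsto_const])
    show "\<forall>\<^sub>F n in sequentially. measure (Pi\<^sub>M {..<n} (\<lambda>_. P)) (?B n) \<le> (\<integral>z. (v z)\<^sup>2 \<partial>P) / \<delta>\<^sup>2 / real n"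
      using eventually_gt_at_top[of 0] by eventually_elim (rule bound)
    show "(\<lambda>n. (\<integral>z. (v z)\<^sup>2 \<partial>P) / \<delta>\<^sup>2 / real n) \<longlonglongrightarrow> 0"
      by (rule lim_const_over_n)
  qed simp
qed

section \<open>Continuous functions of empirical averages\<close>

text \<open>
  Continuity at the population point turns a large error of the plug-in value into a large deviation
  of one of the three averages. The error event enters only through this inclusion in three
  measurable deviation events.
\<close>

lemma plug_in_tendsto_in_prob:
  fixes h :: "real \<times> real \<times> real \<Rightarrow> real" and a b c :: "'z \<Rightarrow> real"
  assumes "prob_space P"
    and a: "integrable P a" "integrable P (\<lambda>z. (a z)\<^sup>2)"
    and b: "integrable P b" "integrable P (\<lambda>z. (b z)\<^sup>2)"
    and c: "integrable P c" "integrable P (\<lambda>z. (c z)\<^sup>2)"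
    and h: "isCont h (\<integral>z. a z \<partial>P, \<integral>z. b z \<partial>P, \<integral>z. c z \<partial>P)" and \<epsilon>: "\<epsilon> > 0"
  shows "(\<lambda>n. measure (Pi\<^sub>M {..<n} (\<lambda>_. P))
      {z \<in> space (Pi\<^sub>M {..<n} (\<lambda>_. P)).
        \<epsilon> < \<bar>h (1 / real n * (\<Sum>i<n. a (z i)), 1 / real n * (\<Sum>i<n. b (z i)), 1 / real n * (\<Sum>i<n. c (z i)))
              - h (\<integral>z. a z \<partial>P, \<integral>z. b z \<partial>P, \<integral>z. c z \<partial>P)\<bar>}) \<longlonglongrightarrow> 0"
    (is "(\<lambda>n. measure _ (?B n)) \<longlonglongrightarrow> 0")
proof -
  let ?p = "(\<integral>z. a z \<partial>P, \<integral>z. b z \<partial>P, \<integral>z. c z \<partial>P)"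
  obtain d where d: "d > 0" "\<And>x. dist x ?p < d \<Longrightarrow> dist (h x) (h ?p) < \<epsilon>"
    using h \<epsilon> unfolding continuous_at_eps_delta by blast
  define D where "D u n = {z \<in> space (Pi\<^sub>M {..<n} (\<lambda>_. P)).
      d / 3 \<le> \<bar>1 / real n * (\<Sum>i<n. u (z i)) - (\<integral>z. u z \<partial>P)\<bar>}" for u and n :: nat
  have lim: "(\<lambda>n. measure (Pi\<^sub>M {..<n} (\<lambda>_. P)) (D a n) + measure (Pi\<^sub>M {..<n} (\<lambda>_. P)) (D b n)
      + measure (Pi\<^sub>M {..<n} (\<lambda>_. P)) (D c n)) \<longlonglongrightarrow> 0"
    unfolding D_def using d(1)
    by (intro tendsto_add_zero sample_mean_tendsto_in_prob assms(1) a b c) auto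
  have "measure (Pi\<^sub>M {..<n} (\<lambda>_. P)) (?B n) \<le> measure (Pi\<^sub>M {..<n} (\<lambda>_. P)) (D a n)
      + measure (Pi\<^sub>M {..<n} (\<lambda>_. P)) (D b n) + measure (Pi\<^sub>M {..<n} (\<lambda>_. P)) (D c n)" for n
  proof -
    let ?Pn = "Pi\<^sub>M {..<n} (\<lambda>_. P)"
    interpret Pn: prob_space ?Pn by (intro prob_space_PiM assms(1))
    have [measurable]: "a \<in> borel_measurable P" "b \<in> borel_measurable P" "c \<in> borel_measurable P"
      using a b c by auto
    have D_sets: "D a n \<in> sets ?Pn" "D b n \<in> sets ?Pn" "D c n \<in> sets ?Pn"
      unfolding D_def by measurable
    have "?B n \<subseteq> D a n \<union> D b n \<union> D c n"
    proof
      fix z assume z: "z \<in> ?B n"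
      let ?x = "1 / real n * (\<Sum>i<n. a (z i))" and ?y = "1 / real n * (\<Sum>i<n. b (z i))"
        and ?w = "1 / real n * (\<Sum>i<n. c (z i))"
      have "\<not> dist (?x, ?y, ?w) ?p < d"
        using z d(2)[of "(?x, ?y, ?w)"] by (auto simp: dist_real_def)
      moreover have "dist (?x, ?y, ?w) ?p \<le> \<bar>?x - (\<integral>z. a z \<partial>P)\<bar> + (\<bar>?y - (\<integral>z. b z \<partial>P)\<bar> + \<bar>?w - (\<integral>z. c z \<partial>P)\<bar>)"
        unfolding dist_Pair_Pair dist_real_def
        by (intro order_trans[OF sqrt_sum_squares_le_sum_abs] add_mono) (auto intro: order_trans[OF sqrt_sum_squares_le_sum_abs])
      ultimately show "z \<in> D a n \<union> D b n \<union> D c n"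
        using z by (auto simp: D_def)
    qed
    then have "measure ?Pn (?B n) \<le> measure ?Pn (D a n \<union> D b n \<union> D c n)"
      using D_sets by (intro Pn.finite_measure_mono) auto
    also have "\<dots> \<le> measure ?Pn (D a n) + measure ?Pn (D b n) + measure ?Pn (D c n)"
      using D_sets by (intro order_trans[OF measure_Un_le] add_mono) auto
    finally show ?thesis .
  qed
  then show ?thesis
    by (intro tendsto_sandwich[OF _ _ tendsto_const lim]) auto
qed

section \<open>Conditioning on an independent variable\<close>

lemma subalgebra_\<sigma>_alg: "W \<in> measurable M S \<Longrightarrow> subalgebra M (\<sigma>_alg M W S)"
  unfolding subalgebra_def \<sigma>_alg_def by (auto simp: in_vimage_algebra sets_image_in_sets)

lemma in_sets_\<sigma>_alg:
  "A \<in> sets S \<Longrightarrow> W -` A \<inter> space M \<in> sets (\<sigma>_alg M W S)"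
  unfolding \<sigma>_alg_def by (rule in_vimage_algebra)

lemma (in prob_space) distr_pair_indep_\<sigma>_alg:
  assumes W [measurable]: "W \<in> measurable M S" and Y [measurable]: "Y \<in> measurable M T"
    and indep: "indep_set (sets (\<sigma>_alg M W S)) (sets (\<sigma>_alg M Y T))"
  shows "distr M (S \<Otimes>\<^sub>M T) (\<lambda>\<omega>. (W \<omega>, Y \<omega>)) = distr M S W \<Otimes>\<^sub>M distr M T Y"
proof (rule sym, rule pair_measure_eqI)
  show "sigma_finite_measure (distr M S W)" "sigma_finite_measure (distr M T Y)"
    by (auto intro!: finite_measure.axioms(1) finite_measure_distr)
  fix A B assume "A \<in> sets (distr M S W)" and "B \<in> sets (distr M T Y)"
  then have A [measurable]: "A \<in> sets S" and B [measurable]: "B \<in> sets T" by auto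
  have "(\<lambda>\<omega>. (W \<omega>, Y \<omega>)) -` (A \<times> B) \<inter> space M = (W -` A \<inter> space M) \<inter> (Y -` B \<inter> space M)"
    by auto
  moreover have "prob ((W -` A \<inter> space M) \<inter> (Y -` B \<inter> space M)) = prob (W -` A \<inter> space M) * prob (Y -` B \<inter> space M)"
    using A B by (intro indep_setD[OF indep] in_sets_\<sigma>_alg)
  ultimately show "emeasure (distr M S W) A * emeasure (distr M T Y) B
      = emeasure (distr M (S \<Otimes>\<^sub>M T) (\<lambda>\<omega>. (W \<omega>, Y \<omega>))) (A \<times> B)"
    by (simp add: emeasure_distr emeasure_eq_measure ennreal_mult)
qed simp

text \<open>
  The freezing lemma. Fubini's theorem for the joint law of \<open>(W, Y)\<close>, which is a product by
  independence, shows that the measure of the slice at \<open>W\<close> has the integrals over events of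
  \<open>\<sigma>(W)\<close> that characterize the conditional probability.
\<close>

lemma (in prob_space) real_cond_exp_indicator_indep:
  assumes W [measurable]: "W \<in> measurable M S" and Y [measurable]: "Y \<in> measurable M T"
    and indep: "indep_set (sets (\<sigma>_alg M W S)) (sets (\<sigma>_alg M Y T))"
    and B [measurable]: "B \<in> sets (S \<Otimes>\<^sub>M T)"
  shows "AE \<omega> in M. real_cond_exp M (\<sigma>_alg M W S) (indicator {\<omega> \<in> space M. (W \<omega>, Y \<omega>) \<in> B}) \<omega>
      = measure (distr M T Y) (Pair (W \<omega>) -` B)"
proof -
  let ?G = "\<sigma>_alg M W S" and ?E = "{\<omega> \<in> space M. (W \<omega>, Y \<omega>) \<in> B}"
  let ?\<mu> = "distr M S W" and ?\<nu> = "distr M T Y"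
  define \<phi> where "\<phi> t = measure ?\<nu> (Pair t -` B)" for t
  interpret G: sigma_finite_subalgebra M ?G
    by (intro finite_measure_subalgebra_is_sigma_finite)
       (simp add: finite_measure_subalgebra_def finite_measure_subalgebra_axioms_def
         finite_measure_axioms subalgebra_\<sigma>_alg)
  interpret \<mu>: prob_space ?\<mu> by (rule prob_space_distr) fact
  interpret \<nu>: prob_space ?\<nu> by (rule prob_space_distr) fact
  interpret \<mu>\<nu>: pair_prob_space ?\<mu> ?\<nu> ..
  have \<phi> [measurable]: "\<phi> \<in> borel_measurable S"
  proof -
    have [measurable]: "(\<lambda>t. emeasure ?\<nu> (Pair t -` B)) \<in> borel_measurable S"
      using B by (intro \<nu>.measurable_emeasure_Pair) simp
    show ?thesis unfolding \<phi>_def measure_def by measurable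
  qed
  have W_G: "W \<in> measurable ?G S"
    unfolding \<sigma>_alg_def by (rule measurable_vimage_algebra1) (use measurable_space[OF W] in auto)
  have "AE \<omega> in M. real_cond_exp M ?G (indicator ?E) \<omega> = \<phi> (W \<omega>)"
  proof (rule G.real_cond_exp_charact)
    fix A assume "A \<in> sets ?G"
    then obtain A' where A' [measurable]: "A' \<in> sets S" and A: "A = W -` A' \<inter> space M"
      unfolding \<sigma>_alg_def using measurable_space[OF W] by (subst (asm) sets_vimage_algebra2) auto
    have "(\<integral>\<omega>\<in>A. indicator ?E \<omega> \<partial>M) = (\<integral>\<omega>. indicat_real ((A' \<times> space T) \<inter> B) (W \<omega>, Y \<omega>) \<partial>M)"
      unfolding set_lebesgue_integral_def A
      by (intro Bochner_Integration.integral_cong) (auto simp: indicator_def measurable_space[OF Y])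
    also have "\<dots> = (\<integral>x. indicat_real ((A' \<times> space T) \<inter> B) x \<partial>(?\<mu> \<Otimes>\<^sub>M ?\<nu>))"
      unfolding distr_pair_indep_\<sigma>_alg[OF W Y indep, symmetric] by (subst integral_distr) auto
    also have "\<dots> = (\<integral>t. \<integral>y. indicat_real ((A' \<times> space T) \<inter> B) (t, y) \<partial>?\<nu> \<partial>?\<mu>)"
      by (intro \<mu>\<nu>.integral_fst'[symmetric] integrable_real_indicator) (auto simp: \<mu>\<nu>.emeasure_eq_measure)
    also have "\<dots> = (\<integral>t. indicat_real A' t * \<phi> t \<partial>?\<mu>)"
    proof (intro Bochner_Integration.integral_cong refl)
      fix t assume "t \<in> space ?\<mu>"
      have sec: "Pair t -` B \<in> sets T" by (rule sets_Pair1[OF B])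
      have "(\<integral>y. indicat_real ((A' \<times> space T) \<inter> B) (t, y) \<partial>?\<nu>)
          = (\<integral>y. indicat_real A' t * indicat_real (Pair t -` B) y \<partial>?\<nu>)"
        by (intro Bochner_Integration.integral_cong) (auto simp: indicator_def)
      also have "\<dots> = indicat_real A' t * \<phi> t"
        unfolding \<phi>_def using sec sets.sets_into_space[OF sec] by (simp add: Int_absorb2)
      finally show "(\<integral>y. indicat_real ((A' \<times> space T) \<inter> B) (t, y) \<partial>?\<nu>) = indicat_real A' t * \<phi> t" .
    qed
    also have "\<dots> = (\<integral>\<omega>. indicat_real A' (W \<omega>) * \<phi> (W \<omega>) \<partial>M)"
      by (subst integral_distr) auto
    also have "\<dots> = (\<integral>\<omega>\<in>A. \<phi> (W \<omega>) \<partial>M)"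
      unfolding set_lebesgue_integral_def A
      by (intro Bochner_Integration.integral_cong) (auto simp: indicator_def)
    finally show "(\<integral>\<omega>\<in>A. indicator ?E \<omega> \<partial>M) = (\<integral>\<omega>\<in>A. \<phi> (W \<omega>) \<partial>M)" .
  next
    show "integrable M (indicator ?E :: _ \<Rightarrow> real)"
      by (intro integrable_real_indicator) (auto simp: emeasure_eq_measure)
    show "integrable M (\<lambda>\<omega>. \<phi> (W \<omega>))"
      using measurable_compose[OF W \<phi>]
      by (intro integrable_const_bound[where B=1]) (auto simp: \<phi>_def)
    show "(\<lambda>\<omega>. \<phi> (W \<omega>)) \<in> borel_measurable ?G"
      using measurable_compose[OF W_G \<phi>] .
  qed
  then show ?thesis by (simp add: \<phi>_def)
qed

text \<open>
  Reduces conditional convergence to convergence under \<open>P\<^sup>n\<close> for each frozen value of \<open>W\<close>.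
  The null sets of the freezing lemma depend on the sample size, and are discarded all at once
  because there are countably many.
\<close>

lemma cond_tendsto0_in_prob_calibration:
  fixes X :: "nat \<Rightarrow> 't \<Rightarrow> (nat \<Rightarrow> 'z) \<Rightarrow> real"
  assumes "prob_space M" and "prob_space P" and W: "W \<in> measurable M S"
    and cal: "\<And>k. calibration_sample M W S P (ncal k) (Z k)"
    and ncal: "filterlim ncal at_top sequentially"
    and X: "\<And>n. (\<lambda>(t, z). X n t z) \<in> borel_measurable (S \<Otimes>\<^sub>M Pi\<^sub>M {..<n} (\<lambda>_. P))"
    and lim: "\<And>\<omega> \<epsilon>. \<omega> \<in> A \<Longrightarrow> \<omega> \<in> space M \<Longrightarrow> \<epsilon> > 0 \<Longrightarrow>
      (\<lambda>n. measure (Pi\<^sub>M {..<n} (\<lambda>_. P)) {z \<in> space (Pi\<^sub>M {..<n} (\<lambda>_. P)). \<epsilon> < \<bar>X n (W \<omega>) z\<bar>}) \<longlonglongrightarrow> 0"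
  shows "cond_tendsto0_in_prob M (\<sigma>_alg M W S) A
    (\<lambda>k \<omega>. X (ncal k) (W \<omega>) (\<lambda>i\<in>{..<ncal k}. Z k i \<omega>))"
  unfolding cond_tendsto0_in_prob_def
proof (intro allI impI)
  fix \<epsilon> :: real assume \<epsilon>: "\<epsilon> > 0"
  interpret prob_space M by fact
  let ?Pn = "\<lambda>n. Pi\<^sub>M {..<n} (\<lambda>_. P)"
  let ?Y = "\<lambda>k \<omega>. \<lambda>i\<in>{..<ncal k}. Z k i \<omega>"
  let ?E = "\<lambda>k. {\<omega> \<in> space M. \<epsilon> < \<bar>X (ncal k) (W \<omega>) (?Y k \<omega>)\<bar>}"
  \<comment> \<open>The restriction to nonempty samples serves the characterization of independence by the joint
    law, which needs a nonempty index set; eventually all samples are nonempty.\<close>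
  have "AE \<omega> in M. ncal k > 0 \<longrightarrow> real_cond_exp M (\<sigma>_alg M W S) (indicator (?E k)) \<omega>
      = measure (?Pn (ncal k)) {z \<in> space (?Pn (ncal k)). \<epsilon> < \<bar>X (ncal k) (W \<omega>) z\<bar>}" for k
  proof (cases "ncal k > 0")
    case pos: True
    let ?n = "ncal k"
    define B where "B = {x \<in> space (S \<Otimes>\<^sub>M ?Pn ?n). \<epsilon> < \<bar>X ?n (fst x) (snd x)\<bar>}"
    have [measurable]: "(\<lambda>x. X ?n (fst x) (snd x)) \<in> borel_measurable (S \<Otimes>\<^sub>M ?Pn ?n)"
      using X[of ?n] by (simp add: case_prod_beta')
    have B: "B \<in> sets (S \<Otimes>\<^sub>M ?Pn ?n)"
      unfolding B_def by measurable
    have indep: "indep_vars (\<lambda>_. P) (Z k) {..<?n}" and law: "\<And>i. i < ?n \<Longrightarrow> distr M P (Z k i) = P"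
      and indepW: "indep_set (sets (\<sigma>_alg M W S)) (sets (\<sigma>_alg M (?Y k) (?Pn ?n)))"
      using cal[of k] unfolding calibration_sample_def by auto
    have Z: "Z k i \<in> measurable M P" if "i \<in> {..<?n}" for i
      using indep that unfolding indep_vars_def by auto
    have Y: "?Y k \<in> measurable M (?Pn ?n)"
      by (intro measurable_restrict Z)
    have "distr M (?Pn ?n) (?Y k) = Pi\<^sub>M {..<?n} (\<lambda>i. distr M P (Z k i))"
      using indep pos Z by (subst (asm) indep_vars_iff_distr_eq_PiM') auto
    also have "\<dots> = ?Pn ?n"
      by (intro PiM_cong) (auto simp: law)
    finally have Y_law: "distr M (?Pn ?n) (?Y k) = ?Pn ?n" .
    have E_eq: "?E k = {\<omega> \<in> space M. (W \<omega>, ?Y k \<omega>) \<in> B}"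
      unfolding B_def using measurable_space[OF W] measurable_space[OF Y]
      by (auto simp: space_pair_measure)
    have slice: "Pair (W \<omega>) -` B = {z \<in> space (?Pn ?n). \<epsilon> < \<bar>X ?n (W \<omega>) z\<bar>}" if "\<omega> \<in> space M" for \<omega>
      unfolding B_def using measurable_space[OF W that] by (auto simp: space_pair_measure)
    show ?thesis
      using real_cond_exp_indicator_indep[OF W Y indepW B] unfolding Y_law E_eq[symmetric]
      using AE_space by eventually_elim (simp add: slice)
  qed simp
  then have "AE \<omega> in M. \<forall>k. ncal k > 0 \<longrightarrow> real_cond_exp M (\<sigma>_alg M W S) (indicator (?E k)) \<omega>
      = measure (?Pn (ncal k)) {z \<in> space (?Pn (ncal k)). \<epsilon> < \<bar>X (ncal k) (W \<omega>) z\<bar>}"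
    by (simp add: AE_all_countable)
  with AE_space
  show "AE \<omega> in M. \<omega> \<in> A \<longrightarrow> (\<lambda>k. real_cond_exp M (\<sigma>_alg M W S) (indicator (?E k)) \<omega>) \<longlonglongrightarrow> 0"
  proof eventually_elim
    case (elim \<omega>)
    show ?case
    proof
      assume A: "\<omega> \<in> A"
      have pos: "\<forall>\<^sub>F k in sequentially. ncal k > 0"
        using eventually_compose_filterlim[OF eventually_gt_at_top[of 0] ncal] .
      have "(\<lambda>k. measure (?Pn (ncal k)) {z \<in> space (?Pn (ncal k)). \<epsilon> < \<bar>X (ncal k) (W \<omega>) z\<bar>}) \<longlonglongrightarrow> 0"
        using filterlim_compose[OF lim[OF A elim(1) \<epsilon>] ncal] .
      then show "(\<lambda>k. real_cond_exp M (\<sigma>_alg M W S) (indicator (?E k)) \<omega>) \<longlonglongrightarrow> 0"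
        by (rule Lim_transform_eventually) (use pos elim(2) in \<open>auto elim!: eventually_mono\<close>)
    qed
  qed
qed

section \<open>Plug-in errors of the calibration estimators\<close>

text \<open>
  Weight and risk are treated together, as two choices of the function h of the triple of risks.
\<close>

definition plug_in_error ::
  "(real \<times> real \<times> real \<Rightarrow> real) \<Rightarrow> ('x \<times> real) measure \<Rightarrow> nat \<Rightarrow> (nat \<Rightarrow> 'x \<times> real)
    \<Rightarrow> ('x \<Rightarrow> real) \<Rightarrow> ('x \<Rightarrow> real) \<Rightarrow> real" where
  "plug_in_error h P n z f g =
     h (emp_risk n z f, emp_risk n z g, emp_cross_risk n z f g)
       - h (risk P f, risk P g, cross_risk P f g)"

lemma plug_in_error_tendsto_in_prob:
  fixes f g :: "'x \<Rightarrow> real"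
  assumes "prob_space P" and "variances_le P f g V"
    and "isCont h (risk P f, risk P g, cross_risk P f g)" and "\<epsilon> > 0"
  shows "(\<lambda>n. measure (Pi\<^sub>M {..<n} (\<lambda>_. P))
      {z \<in> space (Pi\<^sub>M {..<n} (\<lambda>_. P)). \<epsilon> < \<bar>plug_in_error h P n z f g\<bar>}) \<longlonglongrightarrow> 0"
  using assms unfolding variances_le_def variance_le_def plug_in_error_def
    emp_risk_def emp_cross_risk_def risk_def cross_risk_def
  by (intro plug_in_tendsto_in_prob) auto

text \<open>
  Joint measurability in the frozen data and the sample is what the freezing lemma asks for; the
  population risks are measurable functions of the frozen data by Fubini's theorem.
\<close>

lemma borel_measurable_plug_in_error:
  fixes f g :: "'t \<Rightarrow> 'x \<Rightarrow> real" and F :: "'x measure" and P :: "('x \<times> real) measure"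
  assumes "prob_space P" and sets_P: "sets P = sets (F \<Otimes>\<^sub>M borel)"
    and f: "case_prod f \<in> borel_measurable (S \<Otimes>\<^sub>M F)"
    and g: "case_prod g \<in> borel_measurable (S \<Otimes>\<^sub>M F)"
    and h [measurable]: "h \<in> borel_measurable borel"
  shows "(\<lambda>(t, z). plug_in_error h P n z (f t) (g t)) \<in> borel_measurable (S \<Otimes>\<^sub>M Pi\<^sub>M {..<n} (\<lambda>_. P))"
proof -
  interpret P: prob_space P by fact
  have res: "(\<lambda>x. resid (q (fst x)) (snd x)) \<in> borel_measurable (S \<Otimes>\<^sub>M P)"
    if q: "case_prod q \<in> borel_measurable (S \<Otimes>\<^sub>M F)" for q
  proof -
    have "(\<lambda>x. resid (q (fst x)) (snd x)) \<in> borel_measurable (S \<Otimes>\<^sub>M (F \<Otimes>\<^sub>M borel))"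
      using q unfolding resid_def by (measurable)
    then show ?thesis
      by (simp cong: measurable_cong_sets sets_pair_measure_cong add: sets_P)
  qed
  have [measurable]: "(\<lambda>t. risk P (q t)) \<in> borel_measurable S"
    if "case_prod q \<in> borel_measurable (S \<Otimes>\<^sub>M F)" for q
    using res[OF that] unfolding risk_def 
    by (intro P.borel_measurable_lebesgue_integral) (simp add: case_prod_beta')
  note [measurable] = f g res[OF f] res[OF g]
  have [measurable]: "(\<lambda>t. cross_risk P (f t) (g t)) \<in> borel_measurable S"
    unfolding cross_risk_def 
    by (intro P.borel_measurable_lebesgue_integral) (simp add: case_prod_beta')
  have res_i [measurable]: "(\<lambda>x. resid (q (fst x)) (snd x i)) \<in> borel_measurable (S \<Otimes>\<^sub>M Pi\<^sub>M {..<n} (\<lambda>_. P))"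
    if "case_prod q \<in> borel_measurable (S \<Otimes>\<^sub>M F)" "i \<in> {..<n}" for q i
  proof -
    have "(\<lambda>x. (fst x, snd x i)) \<in> measurable (S \<Otimes>\<^sub>M Pi\<^sub>M {..<n} (\<lambda>_. P)) (S \<Otimes>\<^sub>M P)"
      using that(2) by measurable
    from measurable_compose[OF this res[OF that(1)]] show ?thesis by simp
  qed
  have [measurable]: "(\<lambda>x. emp_risk n (snd x) (q (fst x))) \<in> borel_measurable (S \<Otimes>\<^sub>M Pi\<^sub>M {..<n} (\<lambda>_. P))"
    if [measurable]: "case_prod q \<in> borel_measurable (S \<Otimes>\<^sub>M F)" for q
    unfolding emp_risk_def by measurable
  have [measurable]: "(\<lambda>x. emp_cross_risk n (snd x) (f (fst x)) (g (fst x)))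
      \<in> borel_measurable (S \<Otimes>\<^sub>M Pi\<^sub>M {..<n} (\<lambda>_. P))"
    unfolding emp_cross_risk_def by measurable
  show ?thesis
    unfolding plug_in_error_def case_prod_beta' by measurable
qed

lemma plug_in_error_restrict:
  "plug_in_error h P n (\<lambda>i\<in>{..<n}. z i) f g = plug_in_error h P n z f g"
  by (simp add: plug_in_error_def emp_risk_def emp_cross_risk_def)

text \<open>
  The maximum is large only if one of the finitely many errors is, so its error probability is
  at most a finite sum of null sequences.
\<close>

lemma Max_plug_in_error_cond_tendsto0:
  fixes f :: "'t \<Rightarrow> 'x \<Rightarrow> real" and g :: "'j \<Rightarrow> 't \<Rightarrow> 'x \<Rightarrow> real"
    and F :: "'x measure" and P :: "('x \<times> real) measure"
  assumes "prob_space M" and P: "prob_space P" and sets_P: "sets P = sets (F \<Otimes>\<^sub>M borel)"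
    and W: "W \<in> measurable M S"
    and f: "case_prod f \<in> borel_measurable (S \<Otimes>\<^sub>M F)"
    and g: "\<And>j. j \<in> I \<Longrightarrow> case_prod (g j) \<in> borel_measurable (S \<Otimes>\<^sub>M F)"
    and cal: "\<And>k. calibration_sample M W S P (ncal k) (Z k)"
    and ncal: "filterlim ncal at_top sequentially"
    and h: "h \<in> borel_measurable borel"
    and I: "finite I" "I \<noteq> {}"
    and A: "\<And>\<omega> j. \<omega> \<in> A \<Longrightarrow> j \<in> I \<Longrightarrow> variances_le P (f (W \<omega>)) (g j (W \<omega>)) V \<and>
      isCont h (risk P (f (W \<omega>)), risk P (g j (W \<omega>)), cross_risk P (f (W \<omega>)) (g j (W \<omega>)))"
  shows "cond_tendsto0_in_prob M (\<sigma>_alg M W S) A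
    (\<lambda>k \<omega>. MAX j\<in>I. \<bar>plug_in_error h P (ncal k) (\<lambda>i. Z k i \<omega>) (f (W \<omega>)) (g j (W \<omega>))\<bar>)"
proof -
  let ?Pn = "\<lambda>n. Pi\<^sub>M {..<n} (\<lambda>_. P)"
  define X where "X n t z = (MAX j\<in>I. \<bar>plug_in_error h P n z (f t) (g j t)\<bar>)" for n t z
  have plug: "(\<lambda>(t, z). plug_in_error h P n z (f t) (g j t)) \<in> borel_measurable (S \<Otimes>\<^sub>M ?Pn n)"
    if "j \<in> I" for n j
    using that by (intro borel_measurable_plug_in_error[OF P sets_P f _ h] g)
  have "cond_tendsto0_in_prob M (\<sigma>_alg M W S) A
      (\<lambda>k \<omega>. X (ncal k) (W \<omega>) (\<lambda>i\<in>{..<ncal k}. Z k i \<omega>))"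
  proof (rule cond_tendsto0_in_prob_calibration[OF assms(1) P W cal ncal])
    fix n
    show "(\<lambda>(t, z). X n t z) \<in> borel_measurable (S \<Otimes>\<^sub>M ?Pn n)"
      unfolding X_def case_prod_beta' using plug
      by (intro borel_measurable_Max I borel_measurable_abs) (simp add: case_prod_beta')
  next
    fix \<omega> and \<epsilon> :: real assume \<omega>: "\<omega> \<in> A" "\<omega> \<in> space M" and \<epsilon>: "\<epsilon> > 0"
    let ?B = "\<lambda>n j. {z \<in> space (?Pn n). \<epsilon> < \<bar>plug_in_error h P n z (f (W \<omega>)) (g j (W \<omega>))\<bar>}"
    have lim: "(\<lambda>n. \<Sum>j\<in>I. measure (?Pn n) (?B n j)) \<longlonglongrightarrow> 0"
      using A[OF \<omega>(1)] by (intro tendsto_null_sum plug_in_error_tendsto_in_prob[OF P _ _ \<epsilon>]) auto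
    have "measure (?Pn n) {z \<in> space (?Pn n). \<epsilon> < \<bar>X n (W \<omega>) z\<bar>} \<le> (\<Sum>j\<in>I. measure (?Pn n) (?B n j))" for n
    proof -
      interpret Pn: prob_space "?Pn n" by (intro prob_space_PiM P)
      have sets: "?B n j \<in> sets (?Pn n)" if "j \<in> I" for j
      proof -
        have [measurable]: "(\<lambda>z. plug_in_error h P n z (f (W \<omega>)) (g j (W \<omega>))) \<in> borel_measurable (?Pn n)"
          using measurable_Pair2[OF plug[OF that] measurable_space[OF W \<omega>(2)]] by simp
        show ?thesis by measurable
      qed
      have "{z \<in> space (?Pn n). \<epsilon> < \<bar>X n (W \<omega>) z\<bar>} \<subseteq> (\<Union>j\<in>I. ?B n j)"
      proof
        fix z assume z: "z \<in> {z \<in> space (?Pn n). \<epsilon> < \<bar>X n (W \<omega>) z\<bar>}"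
        have "X n (W \<omega>) z \<in> (\<lambda>j. \<bar>plug_in_error h P n z (f (W \<omega>)) (g j (W \<omega>))\<bar>) ` I"
          unfolding X_def using I by (intro Max_in) auto
        with z show "z \<in> (\<Union>j\<in>I. ?B n j)" by auto
      qed
      then have "measure (?Pn n) {z \<in> space (?Pn n). \<epsilon> < \<bar>X n (W \<omega>) z\<bar>} \<le> measure (?Pn n) (\<Union>j\<in>I. ?B n j)"
        using sets I by (intro Pn.finite_measure_mono) auto
      also have "\<dots> \<le> (\<Sum>j\<in>I. measure (?Pn n) (?B n j))"
        using sets I by (intro measure_UNION_le) auto
      finally show ?thesis .
    qed
    then show "(\<lambda>n. measure (?Pn n) {z \<in> space (?Pn n). \<epsilon> < \<bar>X n (W \<omega>) z\<bar>}) \<longlonglongrightarrow> 0"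
      by (intro tendsto_sandwich[OF _ _ tendsto_const lim]) auto
  qed
  then show ?thesis
    by (simp add: X_def plug_in_error_restrict)
qed

section \<open>Optimal mixing weight and risk\<close>

definition mixing_weight :: "real \<times> real \<times> real \<Rightarrow> real" where
  "mixing_weight = (\<lambda>(r, s, c). (r - c) / (r + s - 2 * c))"

definition mixing_risk :: "real \<times> real \<times> real \<Rightarrow> real" where
  "mixing_risk = (\<lambda>(r, s, c). r - (r - c)\<^sup>2 / (r + s - 2 * c))"

lemma borel_measurable_mixing:
  "mixing_weight \<in> borel_measurable borel" "mixing_risk \<in> borel_measurable borel"
  unfolding mixing_weight_def mixing_risk_def borel_prod[symmetric] by measurable

lemma isCont_mixing:
  assumes "r + s - 2 * c \<noteq> 0"
  shows "isCont mixing_weight (r, s, c)" "isCont mixing_risk (r, s, c)"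
  unfolding mixing_weight_def mixing_risk_def case_prod_beta'
  using assms by (auto intro!: continuous_intros)

lemma plug_in_error_mixing:
  "plug_in_error mixing_weight P n z f g = cal_weight n z f g - oracle_weight P f g"
  "plug_in_error mixing_risk P n z f g = cal_risk n z f g - oracle_risk P f g"
  by (simp_all add: plug_in_error_def mixing_weight_def mixing_risk_def cal_weight_def cal_risk_def
      oracle_weight_def oracle_risk_def emp_denom_def oracle_denom_def)

lemma cond_tendsto0_in_prob_abs:
  "cond_tendsto0_in_prob M G A (\<lambda>k \<omega>. \<bar>X k \<omega>\<bar>) \<longleftrightarrow> cond_tendsto0_in_prob M G A X"
  by (simp add: cond_tendsto0_in_prob_def)

theorem mainTheorem9:
  fixes M :: "'w measure" and S :: "'t measure" and F :: "'x measure"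
    and P :: "('x \<times> real) measure"
    and W :: "'w \<Rightarrow> 't"
    and f fpd :: "'t \<Rightarrow> 'x \<Rightarrow> real" and fpdj :: "nat \<Rightarrow> 't \<Rightarrow> 'x \<Rightarrow> real"
    and ncal :: "nat \<Rightarrow> nat" and Z :: "nat \<Rightarrow> nat \<Rightarrow> 'w \<Rightarrow> 'x \<times> real"
    and d0 V :: real and J :: nat
  assumes "prob_space M"
    and "prob_space P" and "sets P = sets (F \<Otimes>\<^sub>M borel)"
    and "W \<in> measurable M S"
    and "case_prod f \<in> borel_measurable (S \<Otimes>\<^sub>M F)"
    and "case_prod fpd \<in> borel_measurable (S \<Otimes>\<^sub>M F)"
    and "\<And>j. j \<in> {1..J} \<Longrightarrow> case_prod (fpdj j) \<in> borel_measurable (S \<Otimes>\<^sub>M F)"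
    and "\<And>k. calibration_sample M W S P (ncal k) (Z k)"
    and "filterlim ncal at_top sequentially"
    and "d0 > 0" and "J \<ge> 1"
  shows
    "let G = \<sigma>_alg M W S;
         A = {\<omega> \<in> space M. oracle_denom P (f (W \<omega>)) (fpd (W \<omega>)) \<ge> d0
                \<and> variances_le P (f (W \<omega>)) (fpd (W \<omega>)) V};
         AJ = {\<omega> \<in> space M. (MIN j\<in>{1..J}. oracle_denom P (f (W \<omega>)) (fpdj j (W \<omega>))) \<ge> d0
                \<and> (\<forall>j\<in>{1..J}. variances_le P (f (W \<omega>)) (fpdj j (W \<omega>)) V)}
     in
       cond_tendsto0_in_prob M G A
         (\<lambda>k \<omega>. cal_weight (ncal k) (\<lambda>i. Z k i \<omega>) (f (W \<omega>)) (fpd (W \<omega>))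
                - oracle_weight P (f (W \<omega>)) (fpd (W \<omega>))) \<and>
       cond_tendsto0_in_prob M G A
         (\<lambda>k \<omega>. cal_risk (ncal k) (\<lambda>i. Z k i \<omega>) (f (W \<omega>)) (fpd (W \<omega>))
                - oracle_risk P (f (W \<omega>)) (fpd (W \<omega>))) \<and>
       cond_tendsto0_in_prob M G AJ
         (\<lambda>k \<omega>. MAX j\<in>{1..J}. \<bar>cal_weight (ncal k) (\<lambda>i. Z k i \<omega>) (f (W \<omega>)) (fpdj j (W \<omega>))
                - oracle_weight P (f (W \<omega>)) (fpdj j (W \<omega>))\<bar>) \<and>
       cond_tendsto0_in_prob M G AJ
         (\<lambda>k \<omega>. MAX j\<in>{1..J}. \<bar>cal_risk (ncal k) (\<lambda>i. Z k i \<omega>) (f (W \<omega>)) (fpdj j (W \<omega>))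
                - oracle_risk P (f (W \<omega>)) (fpdj j (W \<omega>))\<bar>)"
proof -
  let ?G = "\<sigma>_alg M W S"
  let ?A = "\<lambda>I g. {\<omega> \<in> space M. \<forall>j\<in>I. oracle_denom P (f (W \<omega>)) (g j (W \<omega>)) \<ge> d0
      \<and> variances_le P (f (W \<omega>)) (g j (W \<omega>)) V}"
  \<comment> \<open>Stated for an arbitrary finite collection, to be used for the candidates and for the
    one-element collection of the first two claims.\<close>
  have uniform: "cond_tendsto0_in_prob M ?G (?A I g)
      (\<lambda>k \<omega>. MAX j\<in>I. \<bar>cal_weight (ncal k) (\<lambda>i. Z k i \<omega>) (f (W \<omega>)) (g j (W \<omega>))
              - oracle_weight P (f (W \<omega>)) (g j (W \<omega>))\<bar>)"
    "cond_tendsto0_in_prob M ?G (?A I g)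
      (\<lambda>k \<omega>. MAX j\<in>I. \<bar>cal_risk (ncal k) (\<lambda>i. Z k i \<omega>) (f (W \<omega>)) (g j (W \<omega>))
              - oracle_risk P (f (W \<omega>)) (g j (W \<omega>))\<bar>)"
    if I: "finite I" "I \<noteq> {}" and g: "\<And>j. j \<in> I \<Longrightarrow> case_prod (g j) \<in> borel_measurable (S \<Otimes>\<^sub>M F)"
    for I :: "nat set" and g
    unfolding plug_in_error_mixing[symmetric] using \<open>d0 > 0\<close>
    by (intro Max_plug_in_error_cond_tendsto0[OF assms(1-5) g assms(8,9) _ I] borel_measurable_mixing;
        force intro!: isCont_mixing simp: oracle_denom_def)+
  have single: "cond_tendsto0_in_prob M ?G (?A {0} (\<lambda>_. fpd))
      (\<lambda>k \<omega>. cal_weight (ncal k) (\<lambda>i. Z k i \<omega>) (f (W \<omega>)) (fpd (W \<omega>))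
              - oracle_weight P (f (W \<omega>)) (fpd (W \<omega>)))"
    "cond_tendsto0_in_prob M ?G (?A {0} (\<lambda>_. fpd))
      (\<lambda>k \<omega>. cal_risk (ncal k) (\<lambda>i. Z k i \<omega>) (f (W \<omega>)) (fpd (W \<omega>))
              - oracle_risk P (f (W \<omega>)) (fpd (W \<omega>)))"
    using uniform[of "{0}" "\<lambda>_. fpd"] assms(6) by (simp_all add: cond_tendsto0_in_prob_abs)
  have AJ: "{\<omega> \<in> space M. (MIN j\<in>{1..J}. oracle_denom P (f (W \<omega>)) (fpdj j (W \<omega>))) \<ge> d0
      \<and> (\<forall>j\<in>{1..J}. variances_le P (f (W \<omega>)) (fpdj j (W \<omega>)) V)} = ?A {1..J} fpdj"
    using \<open>J \<ge> 1\<close> by auto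
  show ?thesis
    unfolding Let_def AJ using single uniform[of "{1..J}" fpdj] assms(7) \<open>J \<ge> 1\<close> by simp
qed

end
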